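(* Let $n\ge 5$ be an odd integer and let $m\ge 1$ be an integer. Then every Path Union of $m$ copies of the Goldberg Snark graph $G_n$ is a Cordial graph.
   Context: **Goldberg Snark $G_n$.** For an odd integer $n\ge 5$, $G_n$ is the simple undirected cubic graph with the $8n$ vertices $v_{i,j}$ ($1\le i\le n$, $1\le j\le 8$) and the following $12n$ edges, where the first index is read cyclically modulo $n$ (so $v_{n+1,j}=v_{1,j}$). For every $1\le i\le n$: - inside the $i$-th block: $v_{i,1}v_{i,3}$, $v_{i,2}v_{i,4}$, $v_{i,3}v_{i,5}$, $v_{i,5}v_{i,7}$, $v_{i,1}v_{i,6}$, $v_{i,3}v_{i,8}$, $v_{i,1}v_{i,2}$, $v_{i,4}v_{i,5}$, $v_{i,6}v_{i,7}$; - between consecutive blocks: $v_{i,8}v_{i+1,8}$, $v_{i,6}v_{i+1,7}$, $v_{i,4}v_{i+1,2}$. **Path Union.** Given $m$ disjoint copies $G^{(1)},\dots,G^{(m)}$ of a graph $G$, a Path Union of them is a graph obtained from their disjoint union by adding, for each $i\in\{1,\dots,m-1\}$, exactly one edge joining a vertex of $G^{(i)}$ to a vertex of $G^{(i+1)}$. (So it has $m|V(G)|$ vertices and $m|E(G)|+m-1$ edges.) **Cordial graph.** Let $G=(V,E)$ be a finite simple graph. A vertex labeling $f:V(G)\to\{0,1\}$ induces the edge labeling $f^*:E(G)\to\{0,1\}$, $f^*(uv)=|f(u)-f(v)|$. For $i\in\{0,1\}$ let $v_f(i)$ be the number of vertices $v$ with $f(v)=i$, and $e_f(i)$ the number of edges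 $e$ with $f^*(e)=i$. Then $f$ is a Cordial labeling of $G$ if $|v_f(0)-v_f(1)|\le 1$ and $|e_f(0)-e_f(1)|\le 1$. A graph is Cordial if it admits a Cordial labeling. *)

theory Defs
  imports Main
begin

record 'a ugraph =
  verts :: "'a set"
  edges :: "'a set set"

definition simple_graph :: "'a ugraph \<Rightarrow> bool" where
  "simple_graph G \<longleftrightarrow> finite (verts G) \<and> (\<forall>e\<in>edges G. e \<subseteq> verts G \<and> card e = 2)"

definition isomorphic_graphs :: "'a ugraph \<Rightarrow> 'b ugraph \<Rightarrow> bool" where
  "isomorphic_graphs G H \<longleftrightarrow>
     (\<exists>\<phi>. bij_betw \<phi> (verts G) (verts H) \<and> edges H = (\<lambda>e. \<phi> ` e) ` edges G)"

definition path_union :: "nat \<Rightarrow> 'a ugraph \<Rightarrow> 'b ugraph \<Rightarrow> bool" where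
  "path_union m G H \<longleftrightarrow>
     (\<exists>(K :: nat \<Rightarrow> 'b ugraph) a b.
        (\<forall>i\<in>{1..m}. isomorphic_graphs G (K i)) \<and>
        (\<forall>i\<in>{1..m}. \<forall>j\<in>{1..m}. i \<noteq> j \<longrightarrow> verts (K i) \<inter> verts (K j) = {}) \<and>
        (\<forall>i\<in>{1..<m}. a i \<in> verts (K i) \<and> b i \<in> verts (K (i + 1))) \<and>
        verts H = (\<Union>i\<in>{1..m}. verts (K i)) \<and>
        edges H = (\<Union>i\<in>{1..m}. edges (K i)) \<union> {{a i, b i} | i. i \<in> {1..<m}})"

definition cyclic_next :: "nat \<Rightarrow> nat \<Rightarrow> nat" where
  "cyclic_next n i = (if i = n then 1 else i + 1)"

definition goldberg_block_edges :: "nat \<Rightarrow> (nat \<times> nat) set set" where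
  "goldberg_block_edges i =
     {{(i,1),(i,3)}, {(i,2),(i,4)}, {(i,3),(i,5)}, {(i,5),(i,7)}, {(i,1),(i,6)},
      {(i,3),(i,8)}, {(i,1),(i,2)}, {(i,4),(i,5)}, {(i,6),(i,7)}}"

definition goldberg_link_edges :: "nat \<Rightarrow> nat \<Rightarrow> (nat \<times> nat) set set" where
  "goldberg_link_edges n i =
     {{(i,8),(cyclic_next n i,8)}, {(i,6),(cyclic_next n i,7)}, {(i,4),(cyclic_next n i,2)}}"

definition goldberg_snark :: "nat \<Rightarrow> (nat \<times> nat) ugraph" where
  "goldberg_snark n =
     \<lparr> verts = {1..n} \<times> {1..8},
       edges = (\<Union>i\<in>{1..n}. goldberg_block_edges i \<union> goldberg_link_edges n i) \<rparr>"

text \<open>The induced label \<open>|f u - f v|\<close> does not depend on the order in which the ends of the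
  edge are named, so the description below is well defined; see \<open>edge_label_doubleton\<close>.\<close>

definition edge_label :: "('a \<Rightarrow> int) \<Rightarrow> 'a set \<Rightarrow> int" where
  "edge_label f e = (THE l. \<exists>u v. e = {u, v} \<and> l = \<bar>f u - f v\<bar>)"

definition vertex_count :: "'a ugraph \<Rightarrow> ('a \<Rightarrow> int) \<Rightarrow> int \<Rightarrow> nat" where
  "vertex_count G f l = card {v \<in> verts G. f v = l}"

definition edge_count :: "'a ugraph \<Rightarrow> ('a \<Rightarrow> int) \<Rightarrow> int \<Rightarrow> nat" where
  "edge_count G f l = card {e \<in> edges G. edge_label f e = l}"

definition cordial_labeling :: "'a ugraph \<Rightarrow> ('a \<Rightarrow> int) \<Rightarrow> bool" where
  "cordial_labeling G f \<longleftrightarrow>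
     (\<forall>v\<in>verts G. f v \<in> {0, 1}) \<and>
     \<bar>int (vertex_count G f 0) - int (vertex_count G f 1)\<bar> \<le> 1 \<and>
     \<bar>int (edge_count G f 0) - int (edge_count G f 1)\<bar> \<le> 1"

definition cordial_graph :: "'a ugraph \<Rightarrow> bool" where
  "cordial_graph G \<longleftrightarrow> simple_graph G \<and> (\<exists>f. cordial_labeling G f)"

lemma edge_label_doubleton: "edge_label f {u, v} = \<bar>f u - f v\<bar>"
  unfolding edge_label_def by (rule the_equality) (auto simp: doubleton_eq_iff)

lemma simple_graph_goldberg_snark:
  assumes "n \<ge> 2"
  shows "simple_graph (goldberg_snark n)"
  using assms
  by (auto simp: simple_graph_def goldberg_snark_def goldberg_block_edges_def
        goldberg_link_edges_def cyclic_next_def)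

lemma card_verts_goldberg_snark: "card (verts (goldberg_snark n)) = 8 * n"
  by (simp add: goldberg_snark_def card_cartesian_product)

lemma card_edges_goldberg_snark:
  assumes "n \<ge> 3"
  shows "card (edges (goldberg_snark n)) = 12 * n"
proof -
  let ?B = "\<lambda>i. goldberg_block_edges i \<union> goldberg_link_edges n i"
  have fin: "finite (?B i)" for i
    by (simp add: goldberg_block_edges_def goldberg_link_edges_def)
  have c: "card (?B i) = 12" if "i \<in> {1..n}" for i
  proof -
    have "cyclic_next n i \<noteq> i" using that assms by (auto simp: cyclic_next_def)
    then show ?thesis
      by (simp add: goldberg_block_edges_def goldberg_link_edges_def doubleton_eq_iff
          insert_commute)
  qed
  have disj: "?B i \<inter> ?B j = {}" if "i \<in> {1..n}" "j \<in> {1..n}" "i \<noteq> j" for i j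
  proof -
    have "cyclic_next n i \<noteq> cyclic_next n j" "cyclic_next n i \<noteq> i" "cyclic_next n j \<noteq> j"
      "\<not> (cyclic_next n i = j \<and> cyclic_next n j = i)"
      using that assms by (auto simp: cyclic_next_def split: if_splits)
    with \<open>i \<noteq> j\<close> show ?thesis
      by (simp add: goldberg_block_edges_def goldberg_link_edges_def doubleton_eq_iff
          Int_insert_left) auto
  qed
  have "card (\<Union>i\<in>{1..n}. ?B i) = (\<Sum>i\<in>{1..n}. card (?B i))"
    using fin disj by (intro card_UN_disjoint) auto
  also have "\<dots> = 12 * n" using c by simp
  finally show ?thesis by (simp add: goldberg_snark_def)
qed

end

theory Submission
  imports Defs
begin

text \<open>Labelling every block of the snark by ones at the positions 2, 5, 6, 7 and zeros elsewhere
  makes exactly half of the vertices and half of the edges of \<open>G\<^sub>n\<close> carry each label. Replacing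
  such a labelling by its complement preserves both balances but flips the label of a bridge
  to another copy. Choosing the complemented copies one after another, the \<open>i\<close>-th bridge can be
  given the label \<open>i mod 2\<close>, so that the bridges are balanced up to one edge.\<close>

section \<open>Label imbalance as a signed sum\<close>

text \<open>A label l in {0, 1} contributes the sign 1 - 2 * l. In this form the imbalance of a
  labelling is additive over disjoint pieces and can be reindexed along isomorphisms, which is how
  the copies and the bridges are treated separately below.\<close>

lemma card_labels_diff:
  fixes h :: "'a \<Rightarrow> int"
  assumes "finite A" and "\<And>x. x \<in> A \<Longrightarrow> h x \<in> {0, 1}"
  shows "int (card {x \<in> A. h x = 0}) - int (card {x \<in> A. h x = 1}) = (\<Sum>x\<in>A. 1 - 2 * h x)"
  using assms
proof (induction A rule: finite_induct)
  case (insert a A)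
  have *: "{x \<in> insert a A. h x = l} = (if h a = l then insert a {x \<in> A. h x = l} else {x \<in> A. h x = l})"
    for l by auto
  have "h a = 0 \<or> h a = 1" using insert.prems by auto
  moreover have "int (card {x \<in> A. h x = 0}) - int (card {x \<in> A. h x = 1}) = (\<Sum>x\<in>A. 1 - 2 * h x)"
    using insert by blast
  moreover have "finite {x \<in> A. h x = l}" "a \<notin> {x \<in> A. h x = l}" for l
    using insert.hyps by auto
  ultimately show ?case
    unfolding * using insert.hyps by (elim disjE) simp_all
qed simp

lemma simple_graph_edgeE:
  assumes "simple_graph G" and "e \<in> edges G"
  obtains u v where "e = {u, v}" "u \<in> verts G" "v \<in> verts G"
proof -
  have "card e = 2" "e \<subseteq> verts G" using assms by (auto simp: simple_graph_def)
  then show ?thesis using that by (auto simp: card_2_iff)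
qed

lemma simple_graph_finite_edges: "simple_graph G \<Longrightarrow> finite (edges G)"
  by (rule finite_subset[of _ "Pow (verts G)"]) (auto simp: simple_graph_def)

lemma vertex_count_diff:
  assumes "finite (verts G)" and "\<And>v. v \<in> verts G \<Longrightarrow> f v \<in> {0, 1}"
  shows "int (vertex_count G f 0) - int (vertex_count G f 1) = (\<Sum>v\<in>verts G. 1 - 2 * f v)"
  unfolding vertex_count_def using assms by (rule card_labels_diff)

lemma edge_count_diff:
  assumes "simple_graph G" and "\<And>v. v \<in> verts G \<Longrightarrow> f v \<in> {0, 1}"
  shows "int (edge_count G f 0) - int (edge_count G f 1) = (\<Sum>e\<in>edges G. 1 - 2 * edge_label f e)"
  unfolding edge_count_def
proof (rule card_labels_diff)
  show "finite (edges G)" using assms(1) by (rule simple_graph_finite_edges)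
next
  fix e assume "e \<in> edges G"
  then obtain u v where "e = {u, v}" "u \<in> verts G" "v \<in> verts G"
    using assms(1) by (elim simple_graph_edgeE)
  then show "edge_label f e \<in> {0, 1}"
    using assms(2)[of u] assms(2)[of v] by (auto simp: edge_label_doubleton)
qed

section \<open>Arithmetic modulo 2\<close>

text \<open>The terms alternate -1, +1, -1, ..., so every partial sum is -1 or 0. This will be the
  total imbalance of the bridges.\<close>

lemma alternating_sum_bounded: "\<bar>\<Sum>i\<in>{1..<m}. 1 - 2 * (int i mod 2)\<bar> \<le> 1"
proof -
  have "(\<Sum>i\<in>{1..<Suc k}. 1 - 2 * (int i mod 2)) = - (int k mod 2)" for k
  proof (induction k)
    case (Suc k)
    have "(\<Sum>i\<in>{1..<Suc (Suc k)}. 1 - 2 * (int i mod 2)) = - (int k mod 2) + (1 - 2 * (int (Suc k) mod 2))"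
      using Suc.IH by simp
    then show ?case by presburger
  qed simp
  then show ?thesis by (cases m) auto
qed

text \<open>On residues 0 and 1 the absolute difference is addition modulo 2. The induced edge label
  thus becomes linear, and prescribing it on a bridge is a solvable congruence.\<close>

lemma abs_diff_mod_2: "\<bar>p mod 2 - q mod 2\<bar> = (p + q) mod (2::int)"
  by presburger

text \<open>The shift enters twice, as 2 * s, and vanishes modulo 2: complementing a whole copy
  leaves the labels of its inner edges unchanged.\<close>

lemma abs_diff_shift_mod_2:
  assumes "x \<in> {0, 1}" "y \<in> {0, 1::int}"
  shows "\<bar>(s + x) mod 2 - (s + y) mod 2\<bar> = \<bar>x - y\<bar>"
proof -
  have "(s + x) + (s + y) = 2 * s + (x + y)" by simp
  then have "\<bar>(s + x) mod 2 - (s + y) mod 2\<bar> = (x + y) mod 2"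
    unfolding abs_diff_mod_2 by simp
  with assms show ?thesis by auto
qed

text \<open>Complementing multiplies all vertex signs by one common factor, so a vanishing sum of
  signs over a copy still vanishes.\<close>

lemma complement_sign:
  assumes "x \<in> {0, 1::int}"
  shows "1 - 2 * ((s + x) mod 2) = (1 - 2 * (s mod 2)) * (1 - 2 * x)"
proof -
  have "(s + 1) mod 2 = 1 - s mod 2" by presburger
  with assms show ?thesis by auto
qed

section \<open>Path unions of an exactly balanced graph\<close>

lemma simple_graph_isomorphic:
  assumes "simple_graph G" and "bij_betw \<phi> (verts G) (verts K)" and "edges K = (`) \<phi> ` edges G"
  shows "simple_graph K"
  unfolding simple_graph_def
proof (intro conjI ballI)
  show "finite (verts K)"
    using assms(1,2) bij_betw_finite by (auto simp: simple_graph_def)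
next
  fix e assume "e \<in> edges K"
  then obtain e' where e': "e = \<phi> ` e'" "e' \<subseteq> verts G" "card e' = 2"
    using assms(1,3) by (auto simp: simple_graph_def)
  then show "e \<subseteq> verts K" using assms(2) by (auto simp: bij_betw_def)
  have "inj_on \<phi> e'" using e'(2) assms(2) by (auto simp: bij_betw_def intro: inj_on_subset)
  then show "card e = 2" using e' by (simp add: card_image)
qed

text \<open>The balances of \<open>f\<close> are assumed to be exact, not merely within 1, so that
  errors cannot accumulate over the copies: each copy contributes zero, complemented or not, and
  only the m - 1 bridges remain.\<close>

lemma cordial_path_union:
  assumes G: "simple_graph G" and f01: "\<And>v. v \<in> verts G \<Longrightarrow> f v \<in> {0, 1}"
    and fv: "vertex_count G f 0 = vertex_count G f 1"
    and fe: "edge_count G f 0 = edge_count G f 1"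
    and H: "path_union m G H"
  shows "cordial_graph H"
proof -
  obtain K a b where
    iso: "\<forall>i\<in>{1..m}. isomorphic_graphs G (K i)" and
    disj': "\<forall>i\<in>{1..m}. \<forall>j\<in>{1..m}. i \<noteq> j \<longrightarrow> verts (K i) \<inter> verts (K j) = {}" and
    ab': "\<forall>i\<in>{1..<m}. a i \<in> verts (K i) \<and> b i \<in> verts (K (i + 1))" and
    vH: "verts H = (\<Union>i\<in>{1..m}. verts (K i))" and
    eH: "edges H = (\<Union>i\<in>{1..m}. edges (K i)) \<union> {{a i, b i} | i. i \<in> {1..<m}}"
    using H unfolding path_union_def by (elim exE conjE) (rule that)
  have disj: "verts (K i) \<inter> verts (K j) = {}" if "i \<in> {1..m}" "j \<in> {1..m}" "i \<noteq> j" for i j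
    using disj' that by blast
  have ab: "a i \<in> verts (K i) \<and> b i \<in> verts (K (i + 1))" if "i \<in> {1..<m}" for i
    using ab' that by blast
  obtain \<phi> where \<phi>: "\<forall>i\<in>{1..m}. bij_betw (\<phi> i) (verts G) (verts (K i)) \<and> edges (K i) = (`) (\<phi> i) ` edges G"
    using iso unfolding isomorphic_graphs_def by metis
  have bij: "bij_betw (\<phi> i) (verts G) (verts (K i))"
    and eK: "edges (K i) = (`) (\<phi> i) ` edges G" if "i \<in> {1..m}" for i
    using \<phi> that by auto
  have K: "simple_graph (K i)" if "i \<in> {1..m}" for i
    using G bij[OF that] eK[OF that] by (rule simple_graph_isomorphic)
  have finK: "finite (verts (K i))" "finite (edges (K i))" if "i \<in> {1..m}" for i
    using K[OF that] simple_graph_finite_edges by (auto simp: simple_graph_def)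

  \<comment> \<open>Disjointness of the copies makes this choice unique on \<open>verts H\<close>;
    elsewhere the value is unspecified, but only vertices of \<open>H\<close> are counted.\<close>
  define idx where "idx x = (SOME i. i \<in> {1..m} \<and> x \<in> verts (K i))" for x
  have idx: "idx x = i" if "i \<in> {1..m}" "x \<in> verts (K i)" for i x
  proof -
    have "idx x \<in> {1..m} \<and> x \<in> verts (K (idx x))"
      unfolding idx_def by (rule someI[of _ i]) (use that in simp)
    then show ?thesis using disj[of "idx x" i] that by blast
  qed
  define h where "h x = f (inv_into (verts G) (\<phi> (idx x)) x)" for x
  have h: "h (\<phi> i u) = f u" if "i \<in> {1..m}" "u \<in> verts G" for i u
  proof -
    have "\<phi> i u \<in> verts (K i)" using bij that by (auto simp: bij_betw_def)
    then show ?thesis using that bij[of i] idx by (simp add: h_def bij_betw_inv_into_left)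
  qed
  \<comment> \<open>the parity of \<open>s i\<close> decides whether copy \<open>i\<close> is complemented; the increments of \<open>s\<close>
    solve the condition that bridge \<open>i\<close> has label \<open>i mod 2\<close>\<close>
  define s where "s i = (\<Sum>k<i. h (a k) + h (b k) + int k)" for i
  \<comment> \<open>Shifting modulo 2, instead of a case distinction between \<open>h x\<close> and
    its complement, keeps the labels linear in \<open>s\<close>, as the parity lemmas
    require.\<close>
  define g where "g x = (s (idx x) + h x) mod 2" for x
  have g01: "g x \<in> {0, 1}" for x
    unfolding g_def by auto
  have gK: "g (\<phi> i u) = (s i + f u) mod 2" if "i \<in> {1..m}" "u \<in> verts G" for i u
  proof -
    have "\<phi> i u \<in> verts (K i)" using bij that by (auto simp: bij_betw_def)
    then show ?thesis using that h idx by (simp add: g_def)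
  qed

  have vK0: "(\<Sum>v\<in>verts (K i). 1 - 2 * g v) = 0" if i: "i \<in> {1..m}" for i
  proof -
    have "(\<Sum>v\<in>verts (K i). 1 - 2 * g v) = (\<Sum>u\<in>verts G. 1 - 2 * g (\<phi> i u))"
      using sum.reindex_bij_betw[OF bij[OF i], of "\<lambda>v. 1 - 2 * g v"] by simp
    also have "\<dots> = (\<Sum>u\<in>verts G. (1 - 2 * (s i mod 2)) * (1 - 2 * f u))"
      using i f01 by (intro sum.cong refl) (simp only: gK complement_sign)
    also have "\<dots> = (1 - 2 * (s i mod 2)) * (\<Sum>u\<in>verts G. 1 - 2 * f u)"
      by (simp only: sum_distrib_left)
    also have "(\<Sum>u\<in>verts G. 1 - 2 * f u) = 0"
      using vertex_count_diff[of G f] G f01 fv by (simp add: simple_graph_def)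
    finally show ?thesis by simp
  qed
  have eK0: "(\<Sum>e\<in>edges (K i). 1 - 2 * edge_label g e) = 0" if i: "i \<in> {1..m}" for i
  proof -
    have inj: "inj_on ((`) (\<phi> i)) (edges G)"
    proof (rule inj_on_image)
      have "\<Union> (edges G) \<subseteq> verts G" using G by (auto simp: simple_graph_def)
      then show "inj_on (\<phi> i) (\<Union> (edges G))"
        using bij[OF i] by (auto simp: bij_betw_def intro: inj_on_subset)
    qed
    have lab: "edge_label g (\<phi> i ` e) = edge_label f e" if e: "e \<in> edges G" for e
    proof -
      obtain u v where uv: "e = {u, v}" "u \<in> verts G" "v \<in> verts G"
        using G e by (rule simple_graph_edgeE)
      then show ?thesis
        using gK[OF i] abs_diff_shift_mod_2[OF f01 f01, of u v "s i"]
        by (simp add: edge_label_doubleton)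
    qed
    have "(\<Sum>e\<in>edges (K i). 1 - 2 * edge_label g e) = (\<Sum>e\<in>edges G. 1 - 2 * edge_label f e)"
      using inj lab by (simp add: eK[OF i] sum.reindex)
    also have "\<dots> = 0"
      using edge_count_diff[of G f] G f01 fe by simp
    finally show ?thesis .
  qed

  have bridge_label: "edge_label g {a i, b i} = int i mod 2" if i: "i \<in> {1..<m}" for i
  proof -
    have "idx (a i) = i" "idx (b i) = Suc i"
      using ab[OF i] i idx[of i] idx[of "Suc i"] by auto
    then have "edge_label g {a i, b i} = ((s i + h (a i)) + (s (Suc i) + h (b i))) mod 2"
      by (simp add: edge_label_doubleton g_def abs_diff_mod_2)
    \<comment> \<open>Passing from \<open>s i\<close> to \<open>s (Suc i)\<close> adds the summand
      of index i, which doubles both end labels and leaves \<open>int i\<close>. The summand of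
      index 0, where no bridge exists, is absorbed in the even term.\<close>
    also have "(s i + h (a i)) + (s (Suc i) + h (b i)) = int i + 2 * (s i + h (a i) + h (b i))"
      by (simp add: s_def)
    finally show ?thesis by (simp only: mod_mult_self2)
  qed
  \<comment> \<open>\<open>edges H\<close> is a set, so coinciding bridges would be counted only
    once.\<close>
  have bridge_inj: "inj_on (\<lambda>i. {a i, b i}) {1..<m}"
  proof (rule linorder_inj_onI')
    fix i j assume ij: "i \<in> {1..<m}" "j \<in> {1..<m}" "i < j"
    \<comment> \<open>The end \<open>a i\<close> separates the two bridges: it lies in copy i, while
      both ends of the later bridge lie in the copies j and j + 1.\<close>
    have "idx (a i) = i" "idx (a j) = j" "idx (b j) = Suc j"
      using ab[OF ij(1)] ab[OF ij(2)] ij idx[of i "a i"] idx[of j "a j"] idx[of "Suc j" "b j"] by auto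
    then show "{a i, b i} \<noteq> {a j, b j}"
      using ij(3) by (auto simp: doubleton_eq_iff)
  qed
  \<comment> \<open>Nonemptiness is what rules out an edge common to two copies with disjoint vertex
    sets.\<close>
  have eK_sub: "e \<subseteq> verts (K i)" "e \<noteq> {}" if "i \<in> {1..m}" "e \<in> edges (K i)" for i e
    using K[OF that(1)] that(2) by (auto simp: simple_graph_def)
  \<comment> \<open>An edge of a copy has both ends in that copy, whereas a bridge has ends in two
    different copies.\<close>
  have bridge_new: "{a i, b i} \<notin> edges (K j)" if i: "i \<in> {1..<m}" and j: "j \<in> {1..m}" for i j
  proof
    assume "{a i, b i} \<in> edges (K j)"
    then have "a i \<in> verts (K j)" "b i \<in> verts (K j)" using eK_sub[OF j] by auto
    moreover have "idx (a i) = i" "idx (b i) = Suc i"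
      using ab[OF i] i idx[of i] idx[of "Suc i"] by auto
    ultimately show False using idx[OF j] by (metis n_not_Suc_n)
  qed
  have eK_disj: "edges (K i) \<inter> edges (K j) = {}" if "i \<in> {1..m}" "j \<in> {1..m}" "i \<noteq> j" for i j
  proof (rule equals0I)
    fix e assume "e \<in> edges (K i) \<inter> edges (K j)"
    then have "e \<subseteq> verts (K i) \<inter> verts (K j)" "e \<noteq> {}"
      using eK_sub[OF that(1), of e] eK_sub[OF that(2), of e] by auto
    then show False using disj[OF that] by simp
  qed

  have Hs: "simple_graph H"
    unfolding simple_graph_def
  proof (intro conjI ballI)
    show "finite (verts H)" using finK by (simp add: vH)
  next
    fix e assume "e \<in> edges H"
    then consider i where "i \<in> {1..m}" "e \<in> edges (K i)" | i where "i \<in> {1..<m}" "e = {a i, b i}"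
      unfolding eH by blast
    then have "e \<subseteq> verts H \<and> card e = 2"
    proof cases
      case 1
      then show ?thesis using K[OF 1(1)] unfolding vH simple_graph_def by blast
    next
      case 2
      have "a i \<noteq> b i" using ab[OF 2(1)] disj[of i "i + 1"] 2(1) by auto
      moreover have "i \<in> {1..m}" "i + 1 \<in> {1..m}" using 2(1) by auto
      then have "a i \<in> verts H" "b i \<in> verts H" using ab[OF 2(1)] unfolding vH by blast+
      ultimately show ?thesis using 2(2) by simp
    qed
    then show "e \<subseteq> verts H" "card e = 2" by auto
  qed
  have "(\<Sum>v\<in>verts H. 1 - 2 * g v) = (\<Sum>i\<in>{1..m}. \<Sum>v\<in>verts (K i). 1 - 2 * g v)"
    unfolding vH using finK disj by (intro sum.UNION_disjoint) auto
  then have sv: "(\<Sum>v\<in>verts H. 1 - 2 * g v) = 0"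
    using vK0 by simp
  have bridges: "{{a i, b i} | i. i \<in> {1..<m}} = (\<lambda>i. {a i, b i}) ` {1..<m}" by auto
  have "(\<Sum>e\<in>edges H. 1 - 2 * edge_label g e) =
      (\<Sum>e\<in>(\<Union>i\<in>{1..m}. edges (K i)). 1 - 2 * edge_label g e) +
      (\<Sum>e\<in>(\<lambda>i. {a i, b i}) ` {1..<m}. 1 - 2 * edge_label g e)"
    unfolding eH bridges using finK bridge_new by (intro sum.union_disjoint) auto
  also have "(\<Sum>e\<in>(\<Union>i\<in>{1..m}. edges (K i)). 1 - 2 * edge_label g e) =
      (\<Sum>i\<in>{1..m}. \<Sum>e\<in>edges (K i). 1 - 2 * edge_label g e)"
    using finK eK_disj by (intro sum.UNION_disjoint) auto
  also have "\<dots> = 0" using eK0 by simp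
  also have "(\<Sum>e\<in>(\<lambda>i. {a i, b i}) ` {1..<m}. 1 - 2 * edge_label g e) =
      (\<Sum>i\<in>{1..<m}. 1 - 2 * (int i mod 2))"
    using bridge_inj bridge_label by (simp add: sum.reindex)
  finally have se: "\<bar>\<Sum>e\<in>edges H. 1 - 2 * edge_label g e\<bar> \<le> 1"
    using alternating_sum_bounded[of m] by simp
  have "cordial_labeling H g"
    unfolding cordial_labeling_def
    using g01 sv se vertex_count_diff[of H g] edge_count_diff[OF Hs, of g] Hs
    by (simp add: simple_graph_def)
  with Hs show ?thesis unfolding cordial_graph_def by blast
qed

section \<open>The balanced labelling of the Goldberg snark\<close>

text \<open>The label ignores the block index, so a link edge of a given type has the same label
  everywhere, also where block n closes up to block 1. Both balances can therefore be checked within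
  one block.\<close>

definition snark_labeling :: "nat \<times> nat \<Rightarrow> int" where
  "snark_labeling v = (if snd v \<in> {2, 5, 6, 7} then 1 else 0)"

lemma snark_labeling_vertex_balanced:
  "vertex_count (goldberg_snark n) snark_labeling 0 = vertex_count (goldberg_snark n) snark_labeling 1"
proof -
  have "{1..8} = {1, 2, 3, 4, 5, 6, 7, 8::nat}" by auto
  then have "(\<Sum>j\<in>{1..8}. 1 - 2 * snark_labeling (i, j)) = 0" for i
    unfolding snark_labeling_def by simp
  then have "(\<Sum>v\<in>verts (goldberg_snark n). 1 - 2 * snark_labeling v) = 0"
    by (simp add: goldberg_snark_def sum.cartesian_product')
  then show ?thesis
    using vertex_count_diff[of "goldberg_snark n" snark_labeling]
    by (simp add: goldberg_snark_def snark_labeling_def)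
qed

text \<open>Each block together with its outgoing links has six edges labelled 1, at the positions
  2-4, 3-5, 1-6, 1-2, 4-5 and the link 4-2, and six labelled 0.\<close>

lemma snark_labeling_edge_balanced:
  assumes "n \<ge> 3"
  shows "edge_count (goldberg_snark n) snark_labeling 0 = edge_count (goldberg_snark n) snark_labeling 1"
proof -
  let ?B = "\<lambda>i. goldberg_block_edges i \<union> goldberg_link_edges n i"
  have "(\<Sum>e\<in>(\<Union>i\<in>{1..n}. ?B i). 1 - 2 * edge_label snark_labeling e) =
      (\<Sum>i\<in>{1..n}. \<Sum>e\<in>?B i. 1 - 2 * edge_label snark_labeling e)"
  proof (intro sum.UNION_disjoint ballI impI)
    fix i j assume ij: "i \<in> {1..n}" "j \<in> {1..n}" "i \<noteq> j"
    \<comment> \<open>For n \<ge> 3 the cyclic successor has neither fixed points nor 2-cycles. A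
      2-cycle would make the links between positions 8 of the two blocks coincide.\<close>
    then have "cyclic_next n i \<noteq> cyclic_next n j" "cyclic_next n i \<noteq> i" "cyclic_next n j \<noteq> j"
      "\<not> (cyclic_next n i = j \<and> cyclic_next n j = i)"
      using assms by (auto simp: cyclic_next_def split: if_splits)
    with ij(3) show "?B i \<inter> ?B j = {}"
      by (simp add: goldberg_block_edges_def goldberg_link_edges_def doubleton_eq_iff
          Int_insert_left) auto
  qed (auto simp: goldberg_block_edges_def goldberg_link_edges_def)
  also have "\<dots> = 0"
  proof (rule sum.neutral, rule ballI)
    fix i assume "i \<in> {1..n}"
    \<comment> \<open>This keeps the links 6-7 and 4-2 distinct from the block edges at the same
      positions, so that all twelve edges are counted.\<close>
    then have "cyclic_next n i \<noteq> i" using assms by (auto simp: cyclic_next_def)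
    then show "(\<Sum>e\<in>?B i. 1 - 2 * edge_label snark_labeling e) = 0"
      by (simp add: goldberg_block_edges_def goldberg_link_edges_def doubleton_eq_iff
          insert_commute edge_label_doubleton snark_labeling_def)
  qed
  finally have "(\<Sum>e\<in>edges (goldberg_snark n). 1 - 2 * edge_label snark_labeling e) = 0"
    by (simp add: goldberg_snark_def)
  moreover have "simple_graph (goldberg_snark n)"
    using assms by (intro simple_graph_goldberg_snark) simp
  ultimately show ?thesis
    using edge_count_diff[of "goldberg_snark n" snark_labeling] by (simp add: snark_labeling_def)
qed

theorem theorem2:
  fixes n m :: nat and H :: "'a ugraph"
  assumes "n \<ge> 5" and "odd n" and "m \<ge> 1"
    and "path_union m (goldberg_snark n) H"
  shows "cordial_graph H"
proof (rule cordial_path_union[where f = snark_labeling])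
  show "simple_graph (goldberg_snark n)"
    using assms(1) by (intro simple_graph_goldberg_snark) simp
  show "snark_labeling v \<in> {0, 1}" for v
    by (simp add: snark_labeling_def)
  show "edge_count (goldberg_snark n) snark_labeling 0 = edge_count (goldberg_snark n) snark_labeling 1"
    using assms(1) by (intro snark_labeling_edge_balanced) simp
  show "path_union m (goldberg_snark n) H"
    by (fact assms(4))
qed (rule snark_labeling_vertex_balanced)

end
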